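(* Consider a pairwise comparison system with best criteria $b_1,\dots,b_{n_1}$ and worst criteria $w_1,\dots,w_{n_2}$, let $b=b_1$, $w=w_1$, $D=C\setminus\{b,w\}$, $D'=C\setminus\{b_1,\dots,b_{n_1},w_1,\dots,w_{n_2}\}$, and let $D_1,D_2,\epsilon_i,\epsilon_{i,j}$ ($i,j\in D$) be as defined in the context. Let $\epsilon^*$ be the optimal objective value of $$\min\ \epsilon\quad\text{s.t.}\quad \left|\frac{w_{b_1}}{w_i}-a_{bi}\right|\le\epsilon,\ \left|\frac{w_i}{w_{w_1}}-a_{iw}\right|\le\epsilon,\ \left|\frac{w_{b_1}}{w_{w_1}}-a_{bw}\right|\le\epsilon,\ n_1w_{b_1}+n_2w_{w_1}+\sum_{k\in D'}w_k=1,\ w_j\ge0\ \text{ for all } i\in D',\ j\in C,$$ and let $\eta^*$ be the optimal objective value of $$\min\ \eta\quad\text{s.t.}\quad |\tilde a_{bi}-a_{bi}|\le\eta,\ |\tilde a_{iw}-a_{iw}|\le\eta,\ |\tilde a_{bw}-a_{bw}|\le\eta,\ \tilde a_{bi}\tilde a_{iw}=\tilde a_{bw},\ \tilde a_{bi},\tilde a_{iw},\tilde a_{bw}\ge0\ \text{ for all } i\in D'.$$ Then $$\epsilon^*=\eta^*=\max\{\epsilon_i,\epsilon_{i,j}:i,j\in D\}.$$ Also, the collection of all optimally modified PCS is $$\tilde a_{bw}^*=\begin{cases}a_{bw}-\epsilon_{i_0}&\text{if }\eta^*=\epsilon_{i_0}\text{ for some }i_0\in D_1,\\ a_{bw}+\epsilon_{j_0}&\text{if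 }\eta^*=\epsilon_{j_0}\text{ for some }j_0\in D_2,\\ (a_{bi_0}+\epsilon_{i_0,j_0})(a_{i_0w}+\epsilon_{i_0,j_0})&\text{if }\eta^*=\epsilon_{i_0,j_0}\text{ for some }i_0,j_0\in D,\end{cases}$$ $$\tilde a_{iw}^*\in\left[\max\left\{a_{iw}-\epsilon^*,\frac{\tilde a_{bw}^*}{a_{bi}+\epsilon^*}\right\},\ \min\left\{a_{iw}+\epsilon^*,\frac{\tilde a_{bw}^*}{a_{bi}-\epsilon^*}\right\}\right]\quad\text{with}\quad \tilde a_{bi}^*=\frac{\tilde a_{bw}^*}{\tilde a_{iw}^*}\quad\text{for all } i\in D'.$$
   Context: $C=\{1,\dots,n\}$ is the set of criteria. There are $n_1\ge1$ equally preferred best criteria $b_1,\dots,b_{n_1}$ and $n_2\ge1$ equally preferred worst criteria $w_1,\dots,w_{n_2}$, all distinct, with $n_1\ge2$ or $n_2\ge2$. The number $a_{ij}$ is the relative preference of criterion $i$ over criterion $j$. Equal preference means that $a_{b_ki}=a_{bi}$, $a_{iw_l}=a_{iw}$, $a_{b_kw_l}=a_{bw}$ do not depend on $k,l$ (for $i\in D'$), that $a_{bb_k}=1$, $a_{b_kw}=a_{bw}$ for all $k$, and $a_{w_lw}=1$, $a_{bw_l}=a_{bw}$ for all $l$. All these are real numbers with $1\le a_{bi},a_{iw}\le a_{bw}$ for all $i\in D$. In the weight problem, the variable $w_j$ is the weight of criterion $j$ (so $w_{b_1}$ and $w_{w_1}$ are the weights of the criteria $b_1$ and $w_1$), and denominators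 are required to be nonzero. $D_1=\{i\in D:a_{bi}a_{iw}<a_{bw}\}$, $D_2=\{i\in D:a_{bi}a_{iw}>a_{bw}\}$, and for $i,j\in D$ $$\epsilon_i=\left|\frac{a_{bi}+a_{iw}+1-\sqrt{(a_{bi}+a_{iw}+1)^2-4(a_{bi}a_{iw}-a_{bw})}}{2}\right|,\qquad \epsilon_{i,j}=\left|\frac{a_{bi}a_{iw}-a_{bj}a_{jw}}{a_{bi}+a_{iw}+a_{bj}+a_{jw}}\right|.$$ An optimally modified PCS is a family $\tilde a_{bi}^*,\tilde a_{iw}^*$ ($i\in D'$), $\tilde a_{bw}^*$ that together with $\eta^*$ forms an optimal solution of the second (the $\eta$-) minimization problem, completed by $\tilde a_{bb}^*=\tilde a_{ww}^*=1$.
   Formalization: The upper bound ã_bw*/(a_bi−ε* ) is dropped when a_bi ≤ ε* (as printed, the interval is then empty or undefined), and in the third case i_0, j_0 are labelled so that a_{bi_0}a_{i_0w} ≤ a_{bj_0}a_{j_0w}, since ε_{i,j} is symmetric but the printed value is not. *)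

theory Defs
  imports Complex_Main "HOL-Library.FuncSet"
begin

text \<open>
  The preference \<open>a i j\<close> of criterion \<open>i\<close> over criterion \<open>j\<close> is only constrained, and only used,
  at the entries with a best criterion in the first or a worst criterion in the second place.
  The functions \<open>bs\<close> and \<open>ws\<close> list the best and worst criteria and are only relevant on
  \<open>{1..n1}\<close> and \<open>{1..n2}\<close>.
\<close>

definition crit_rest :: "nat \<Rightarrow> nat \<Rightarrow> nat \<Rightarrow> (nat \<Rightarrow> nat) \<Rightarrow> (nat \<Rightarrow> nat) \<Rightarrow> nat set" where
  "crit_rest n n1 n2 bs ws = {1..n} - (bs ` {1..n1} \<union> ws ` {1..n2})"

definition multi_pcs ::
  "nat \<Rightarrow> nat \<Rightarrow> nat \<Rightarrow> (nat \<Rightarrow> nat) \<Rightarrow> (nat \<Rightarrow> nat) \<Rightarrow> (nat \<Rightarrow> nat \<Rightarrow> real) \<Rightarrow> bool" where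
  "multi_pcs n n1 n2 bs ws a \<longleftrightarrow>
     1 \<le> n1 \<and> 1 \<le> n2 \<and> (2 \<le> n1 \<or> 2 \<le> n2) \<and>
     bs ` {1..n1} \<subseteq> {1..n} \<and> ws ` {1..n2} \<subseteq> {1..n} \<and>
     inj_on bs {1..n1} \<and> inj_on ws {1..n2} \<and> bs ` {1..n1} \<inter> ws ` {1..n2} = {} \<and>
     (\<forall>k\<in>{1..n1}. \<forall>i\<in>crit_rest n n1 n2 bs ws. a (bs k) i = a (bs 1) i) \<and>
     (\<forall>l\<in>{1..n2}. \<forall>i\<in>crit_rest n n1 n2 bs ws. a i (ws l) = a i (ws 1)) \<and>
     (\<forall>k\<in>{1..n1}. \<forall>l\<in>{1..n2}. a (bs k) (ws l) = a (bs 1) (ws 1)) \<and>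
     (\<forall>k\<in>{1..n1}. a (bs 1) (bs k) = 1) \<and>
     (\<forall>l\<in>{1..n2}. a (ws l) (ws 1) = 1) \<and>
     (\<forall>i\<in>{1..n} - {bs 1, ws 1}.
        1 \<le> a (bs 1) i \<and> a (bs 1) i \<le> a (bs 1) (ws 1) \<and>
        1 \<le> a i (ws 1) \<and> a i (ws 1) \<le> a (bs 1) (ws 1))"

definition D_less :: "nat set \<Rightarrow> (nat \<Rightarrow> nat \<Rightarrow> real) \<Rightarrow> nat \<Rightarrow> nat \<Rightarrow> nat set" where
  "D_less D a b w = {i \<in> D. a b i * a i w < a b w}"

definition D_greater :: "nat set \<Rightarrow> (nat \<Rightarrow> nat \<Rightarrow> real) \<Rightarrow> nat \<Rightarrow> nat \<Rightarrow> nat set" where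
  "D_greater D a b w = {i \<in> D. a b i * a i w > a b w}"

definition eps_single :: "(nat \<Rightarrow> nat \<Rightarrow> real) \<Rightarrow> nat \<Rightarrow> nat \<Rightarrow> nat \<Rightarrow> real" where
  "eps_single a b w i =
     \<bar>(a b i + a i w + 1 - sqrt ((a b i + a i w + 1)^2 - 4 * (a b i * a i w - a b w))) / 2\<bar>"

definition eps_pair :: "(nat \<Rightarrow> nat \<Rightarrow> real) \<Rightarrow> nat \<Rightarrow> nat \<Rightarrow> nat \<Rightarrow> nat \<Rightarrow> real" where
  "eps_pair a b w i j =
     \<bar>(a b i * a i w - a b j * a j w) / (a b i + a i w + a b j + a j w)\<bar>"

text \<open>
  The weight problem. Only \<open>b = bs 1\<close> and \<open>w = ws 1\<close> occur in the constraints; the weights of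
  the remaining best and worst criteria are only required to be nonnegative.
\<close>

definition weight_feasible ::
  "nat \<Rightarrow> nat \<Rightarrow> nat \<Rightarrow> nat set \<Rightarrow> (nat \<Rightarrow> nat \<Rightarrow> real) \<Rightarrow> nat \<Rightarrow> nat \<Rightarrow>
   (nat \<Rightarrow> real) \<Rightarrow> real \<Rightarrow> bool" where
  "weight_feasible n n1 n2 D' a b w v \<epsilon> \<longleftrightarrow>
     (\<forall>i\<in>D'. v i \<noteq> 0 \<and> \<bar>v b / v i - a b i\<bar> \<le> \<epsilon> \<and> \<bar>v i / v w - a i w\<bar> \<le> \<epsilon>) \<and>
     v w \<noteq> 0 \<and> \<bar>v b / v w - a b w\<bar> \<le> \<epsilon> \<and>
     real n1 * v b + real n2 * v w + (\<Sum>k\<in>D'. v k) = 1 \<and>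
     (\<forall>j\<in>{1..n}. 0 \<le> v j)"

definition eps_star ::
  "nat \<Rightarrow> nat \<Rightarrow> nat \<Rightarrow> nat set \<Rightarrow> (nat \<Rightarrow> nat \<Rightarrow> real) \<Rightarrow> nat \<Rightarrow> nat \<Rightarrow> real" where
  "eps_star n n1 n2 D' a b w = Inf {\<epsilon>. \<exists>v. weight_feasible n n1 n2 D' a b w v \<epsilon>}"

text \<open>Here \<open>p i\<close>, \<open>q i\<close>, \<open>z\<close> are the modified values of \<open>a b i\<close>, \<open>a i w\<close>, \<open>a b w\<close>.\<close>

definition modified_feasible ::
  "nat set \<Rightarrow> (nat \<Rightarrow> nat \<Rightarrow> real) \<Rightarrow> nat \<Rightarrow> nat \<Rightarrow>
   (nat \<Rightarrow> real) \<Rightarrow> (nat \<Rightarrow> real) \<Rightarrow> real \<Rightarrow> real \<Rightarrow> bool" where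
  "modified_feasible D' a b w p q z \<eta> \<longleftrightarrow>
     (\<forall>i\<in>D'. \<bar>p i - a b i\<bar> \<le> \<eta> \<and> \<bar>q i - a i w\<bar> \<le> \<eta> \<and> p i * q i = z \<and> 0 \<le> p i \<and> 0 \<le> q i) \<and>
     \<bar>z - a b w\<bar> \<le> \<eta> \<and> 0 \<le> z"

text \<open>
  As for \<open>eps_star\<close>, the infimum is the optimal objective value once the problem is
  shown to be feasible at it, and then the optimal solutions are the points feasible at it.
\<close>

definition eta_star :: "nat set \<Rightarrow> (nat \<Rightarrow> nat \<Rightarrow> real) \<Rightarrow> nat \<Rightarrow> nat \<Rightarrow> real" where
  "eta_star D' a b w = Inf {\<eta>. \<exists>p q z. modified_feasible D' a b w p q z \<eta>}"

text \<open>
  A modified PCS is a pair \<open>(p, q)\<close> of families over \<open>D' \<union> {b, w}\<close>, extensional so that it carries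
  no values at other indices. The value \<open>z\<close> modifying \<open>a b w\<close> is both \<open>p w\<close> and \<open>q b\<close>.
\<close>

definition completed_pcs ::
  "nat set \<Rightarrow> nat \<Rightarrow> nat \<Rightarrow> real \<Rightarrow> ((nat \<Rightarrow> real) \<times> (nat \<Rightarrow> real)) set" where
  "completed_pcs D' b w z =
     {(p, q). p \<in> extensional (D' \<union> {b, w}) \<and> q \<in> extensional (D' \<union> {b, w}) \<and>
              p b = 1 \<and> q w = 1 \<and> p w = z \<and> q b = z}"

definition optimally_modified_pcs ::
  "nat set \<Rightarrow> (nat \<Rightarrow> nat \<Rightarrow> real) \<Rightarrow> nat \<Rightarrow> nat \<Rightarrow> ((nat \<Rightarrow> real) \<times> (nat \<Rightarrow> real)) set" where
  "optimally_modified_pcs D' a b w =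
     {(p, q). \<exists>z. (p, q) \<in> completed_pcs D' b w z \<and>
                  modified_feasible D' a b w p q z (eta_star D' a b w)}"

text \<open>
  The three-case formula for the modified value of \<open>a b w\<close>. Since \<open>eps_pair\<close> is symmetric in
  \<open>i\<close> and \<open>j\<close> while the value in the third case is not, the pair has to be labelled
  so that the first criterion has the smaller product.
\<close>

definition modified_abw ::
  "nat set \<Rightarrow> (nat \<Rightarrow> nat \<Rightarrow> real) \<Rightarrow> nat \<Rightarrow> nat \<Rightarrow> real \<Rightarrow> real \<Rightarrow> bool" where
  "modified_abw D a b w \<eta> z \<longleftrightarrow>
     (\<exists>i\<in>D_less D a b w. \<eta> = eps_single a b w i \<and> z = a b w - eps_single a b w i) \<or>
     (\<exists>j\<in>D_greater D a b w. \<eta> = eps_single a b w j \<and> z = a b w + eps_single a b w j) \<or>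
     (\<exists>i\<in>D. \<exists>j\<in>D. a b i * a i w \<le> a b j * a j w \<and> \<eta> = eps_pair a b w i j \<and>
        z = (a b i + eps_pair a b w i j) * (a i w + eps_pair a b w i j))"

text \<open>
  For \<open>x = a b i\<close>, \<open>y = a i w\<close>. The bound \<open>z / (x - \<epsilon>)\<close> expresses \<open>x - \<epsilon> \<le> z / q\<close> for
  \<open>q > 0\<close>; this is vacuous if \<open>x \<le> \<epsilon>\<close>, and the bound is then read as \<open>\<infinity>\<close>.
\<close>

definition upper_aiw :: "real \<Rightarrow> real \<Rightarrow> real \<Rightarrow> real \<Rightarrow> real" where
  "upper_aiw x y \<epsilon> z = (if \<epsilon> < x then min (y + \<epsilon>) (z / (x - \<epsilon>)) else y + \<epsilon>)"

end

theory Submission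
  imports Defs
begin

text \<open>
  Fix a radius \<open>t \<ge> 0\<close> and ask which values \<open>z\<close> may replace \<open>a b w\<close>. A criterion with preferences
  \<open>x = a b i\<close> and \<open>y = a i w\<close> admits \<open>p * q = z\<close> with \<open>p\<close>, \<open>q\<close> nonnegative and within \<open>t\<close> of \<open>x\<close>, \<open>y\<close>
  exactly when \<open>z\<close> lies between the lower barrier \<open>max 0 (x - t) * max 0 (y - t)\<close> and the upper
  barrier \<open>(x + t) * (y + t)\<close>; the entry \<open>a b w\<close> itself contributes the barriers \<open>a b w - t\<close> and
  \<open>a b w + t\<close>. As \<open>t\<close> grows, upper barriers rise strictly and lower barriers do not rise, so a lower
  and an upper barrier that start in the wrong order are in the right order exactly from their
  crossing time on. These crossing times are the \<open>eps_single\<close> and \<open>eps_pair\<close>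
  (\<open>eps_single_crossing_upper\<close>, \<open>eps_single_crossing_lower\<close>, \<open>eps_pair_crossing\<close>). Hence the least
  feasible radius is their maximum. At that radius one lower barrier coincides with one upper
  barrier, and their common value, which is what the three-case formula computes, is the only
  admissible \<open>z\<close> (\<open>modified_abw_iff_admissible\<close>).

  The barriers are taken over all of \<open>D\<close> although the constraints range only over \<open>D'\<close>. This is
  harmless: a further best or worst criterion has preferences \<open>1\<close> and \<open>a b w\<close> in some order, and
  for \<open>z \<ge> 0\<close> its barriers are implied by those of \<open>a b w\<close>. Such a criterion always exists, so \<open>D\<close> is nonempty,
  and this settles the case in which the maximum is \<open>0\<close>, where the three-case formula
  can only apply through a pair.

  Finally, ratios of weights form a modified system, and a modified system with \<open>z > 0\<close> comes
  from the weights \<open>v b : v i : v w = z : q i : 1\<close>. Since the unique \<open>z\<close> at the optimum is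
  an upper barrier, it is positive, so both problems have the same optimal value.
\<close>

section \<open>Barriers and their crossing times\<close>

definition lower_barrier :: "real \<Rightarrow> real \<Rightarrow> real \<Rightarrow> real" where
  "lower_barrier x y t = max 0 (x - t) * max 0 (y - t)"

definition upper_barrier :: "real \<Rightarrow> real \<Rightarrow> real \<Rightarrow> real" where
  "upper_barrier x y t = (x + t) * (y + t)"

lemma lower_barrier_commute: "lower_barrier x y t = lower_barrier y x t"
  by (simp add: lower_barrier_def)

lemma upper_barrier_commute: "upper_barrier x y t = upper_barrier y x t"
  by (simp add: upper_barrier_def)

lemma lower_barrier_antimono: "s \<le> t \<Longrightarrow> lower_barrier x y t \<le> lower_barrier x y s"
  unfolding lower_barrier_def by (intro mult_mono) auto

lemma upper_barrier_strict_mono: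
  assumes "0 < x" "0 < y" "0 \<le> s" "s < t"
  shows "upper_barrier x y s < upper_barrier x y t"
  unfolding upper_barrier_def using assms by (intro mult_strict_mono) auto

lemma upper_barrier_mono:
  assumes "0 < x" "0 < y" "0 \<le> s" "s \<le> t"
  shows "upper_barrier x y s \<le> upper_barrier x y t"
  unfolding upper_barrier_def using assms by (intro mult_mono) auto

lemma upper_barrier_pos:
  assumes "0 < x" "0 < y" "0 \<le> t"
  shows "0 < upper_barrier x y t"
  unfolding upper_barrier_def using assms by (intro mult_pos_pos) auto

lemma product_le_upper_barrier:
  assumes "0 < x" "0 < y" "0 \<le> t"
  shows "x * y \<le> upper_barrier x y t"
  using upper_barrier_mono[of x y 0 t] assms by (simp add: upper_barrier_def)

lemma lower_barrier_le_product:
  assumes "0 < x" "0 < y" "0 \<le> t"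
  shows "lower_barrier x y t \<le> x * y"
  using lower_barrier_antimono[of 0 t x y] assms by (simp add: lower_barrier_def)

text \<open>
  The strict growth of \<open>h\<close> makes the crossing unique, so the time of the crossing can be read off from
  the order of the barriers.
\<close>

lemma crossing_le_iff:
  fixes l h :: "real \<Rightarrow> real"
  assumes "\<And>s t. 0 \<le> s \<Longrightarrow> s < t \<Longrightarrow> h s < h t"
    and "\<And>s t. 0 \<le> s \<Longrightarrow> s \<le> t \<Longrightarrow> l t \<le> l s"
    and "l e = h e" "0 \<le> e" "0 \<le> t"
  shows "e \<le> t \<longleftrightarrow> l t \<le> h t"
proof
  assume "e \<le> t"
  then have "l t \<le> l e" "h e \<le> h t"
    using assms(1)[of e t] assms(2)[of e t] assms(4) by (auto simp: le_less)
  then show "l t \<le> h t" using assms(3) by simp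
next
  assume *: "l t \<le> h t"
  show "e \<le> t"
  proof (rule ccontr)
    assume "\<not> e \<le> t"
    then have "h t < h e" "l e \<le> l t"
      using assms(1)[of t e] assms(2)[of t e] assms(5) by auto
    then show False using * assms(3) by simp
  qed
qed

lemma eps_single_nonneg: "0 \<le> eps_single a b w i"
  by (simp add: eps_single_def)

lemma eps_pair_nonneg: "0 \<le> eps_pair a b w i j"
  by (simp add: eps_pair_def)

lemma eps_pair_commute: "eps_pair a b w i j = eps_pair a b w j i"
proof -
  have "a b i * a i w - a b j * a j w = - (a b j * a j w - a b i * a i w)" by simp
  then show ?thesis
    unfolding eps_pair_def abs_divide by (simp add: abs_minus_commute add_ac)
qed

text \<open>
  Both crossing equations with the barriers of \<open>a b w\<close> are quadratic, and they are obtained from each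
  other by \<open>t \<mapsto> - t\<close>; this is why a single formula with an absolute value covers both signs.
\<close>

lemma eps_single_crossing_upper:
  assumes "0 < a b i" "0 < a i w" "a b i * a i w \<le> a b w"
  shows "a b w - eps_single a b w i = upper_barrier (a b i) (a i w) (eps_single a b w i)"
proof -
  define x y A where "x = a b i" and "y = a i w" and "A = a b w"
  define d where "d = (x + y + 1)^2 - 4 * (x * y - A)"
  have pos: "0 < x" "0 < y" "x * y \<le> A"
    using assms by (auto simp: x_def y_def A_def)
  have "(x + y + 1)^2 \<le> d" using pos by (simp add: d_def)
  then have r: "x + y + 1 \<le> sqrt d" and "0 \<le> d"
    by (auto intro: real_le_rsqrt order_trans[OF zero_le_power2])
  have "eps_single a b w i = \<bar>(x + y + 1 - sqrt d) / 2\<bar>"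
    by (simp add: eps_single_def d_def x_def y_def A_def)
  then have e: "eps_single a b w i = (sqrt d - (x + y + 1)) / 2"
    using r by (simp add: abs_if field_simps)
  define e where "e = eps_single a b w i"
  have "sqrt d = 2 * e + (x + y + 1)" using e by (simp add: e_def)
  then have "(2 * e + (x + y + 1))^2 = d" using \<open>0 \<le> d\<close> by (metis real_sqrt_pow2)
  then have "A - e = (x + e) * (y + e)"
    unfolding d_def by (simp add: power2_eq_square algebra_simps)
  then show ?thesis by (simp add: upper_barrier_def e_def x_def y_def A_def)
qed

text \<open>
  The crossing happens while \<open>x - t\<close> and \<open>y - t\<close> are still nonnegative, so truncating the lower
  barrier at \<open>0\<close> does not affect it.
\<close>

lemma eps_single_crossing_lower:
  assumes "0 < a b i" "0 < a i w" "a b w \<le> a b i * a i w" "0 \<le> a b w"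
  shows "lower_barrier (a b i) (a i w) (eps_single a b w i) = a b w + eps_single a b w i"
proof -
  define x y A where "x = a b i" and "y = a i w" and "A = a b w"
  define d where "d = (x + y + 1)^2 - 4 * (x * y - A)"
  have pos: "0 < x" "0 < y" "A \<le> x * y" "0 \<le> A"
    using assms by (auto simp: x_def y_def A_def)
  have dx: "d = (y - x + 1)^2 + 4 * (x + A)" and dy: "d = (x - y + 1)^2 + 4 * (y + A)"
    by (simp_all add: d_def power2_eq_square algebra_simps)
  have "0 \<le> d" using dx pos by simp
  have rx: "y - x + 1 \<le> sqrt d" and ry: "x - y + 1 \<le> sqrt d"
    using dx dy pos by (auto intro!: real_le_rsqrt)
  have "d \<le> (x + y + 1)^2" using pos by (simp add: d_def)
  then have r: "sqrt d \<le> x + y + 1"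
    using pos by (intro real_le_lsqrt) auto
  have "eps_single a b w i = \<bar>(x + y + 1 - sqrt d) / 2\<bar>"
    by (simp add: eps_single_def d_def x_def y_def A_def)
  then have e: "eps_single a b w i = ((x + y + 1) - sqrt d) / 2"
    using r by (simp add: abs_if field_simps)
  define e where "e = eps_single a b w i"
  have "sqrt d = (x + y + 1) - 2 * e" using e by (simp add: e_def)
  then have "((x + y + 1) - 2 * e)^2 = d" using \<open>0 \<le> d\<close> by (metis real_sqrt_pow2)
  then have "(x - e) * (y - e) = A + e"
    unfolding d_def by (simp add: power2_eq_square algebra_simps)
  moreover have "e \<le> x" "e \<le> y" using e rx ry by (auto simp: e_def)
  ultimately show ?thesis by (simp add: lower_barrier_def e_def x_def y_def A_def)
qed

text \<open>
  In the crossing equation for two criteria the squares of \<open>t\<close> cancel, which makes it linear. The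
  crossing time is at most \<open>x y / (x + y)\<close> for the criterion with the larger product, hence below its
  \<open>x\<close> and \<open>y\<close>, and the truncation is again inactive.
\<close>

lemma eps_pair_crossing:
  assumes "0 < a b i" "0 < a i w" "0 < a b j" "0 < a j w"
    and "a b i * a i w \<le> a b j * a j w"
  shows "lower_barrier (a b j) (a j w) (eps_pair a b w i j)
       = upper_barrier (a b i) (a i w) (eps_pair a b w i j)"
proof -
  define x y u v where "x = a b i" and "y = a i w" and "u = a b j" and "v = a j w"
  define e where "e = eps_pair a b w i j"
  have pos: "0 < x" "0 < y" "0 < u" "0 < v" "x * y \<le> u * v"
    using assms by (auto simp: x_def y_def u_def v_def)
  have "e = (u * v - x * y) / (x + y + u + v)"
    unfolding e_def eps_pair_def abs_divide using pos
    by (simp add: x_def y_def u_def v_def abs_if)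
  then have lin: "e * (x + y + u + v) = u * v - x * y" using pos by simp
  have "0 \<le> e" by (simp add: e_def eps_pair_nonneg)
  have "e * v \<le> u * v" "e * u \<le> v * u"
  proof -
    have "0 \<le> e * x" "0 \<le> e * y" "0 \<le> e * u" "0 \<le> e * v" "0 \<le> x * y"
      using pos \<open>0 \<le> e\<close> by auto
    then show "e * v \<le> u * v" "e * u \<le> v * u" using lin by (auto simp: algebra_simps)
  qed
  then have "e \<le> u" "e \<le> v" using pos by auto
  moreover have "(u - e) * (v - e) = (x + e) * (y + e)"
    using lin by (simp add: algebra_simps)
  ultimately show ?thesis
    by (simp add: lower_barrier_def upper_barrier_def e_def x_def y_def u_def v_def)
qed

section \<open>The least radius and the admissible value\<close>

text \<open>
  Positive preferences make the upper barriers positive and strictly increasing; a nonempty \<open>D\<close> gives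
  the maximum of the errors a meaning.
\<close>

locale best_worst_preferences =
  fixes D :: "nat set" and a :: "nat \<Rightarrow> nat \<Rightarrow> real" and b w :: nat
  assumes finite_D: "finite D" and D_nonempty: "D \<noteq> {}"
    and bw_pos: "0 < a b w"
    and bi_pos: "i \<in> D \<Longrightarrow> 0 < a b i"
    and iw_pos: "i \<in> D \<Longrightarrow> 0 < a i w"
begin

abbreviation lower :: "nat \<Rightarrow> real \<Rightarrow> real" where
  "lower i \<equiv> lower_barrier (a b i) (a i w)"

abbreviation upper :: "nat \<Rightarrow> real \<Rightarrow> real" where
  "upper i \<equiv> upper_barrier (a b i) (a i w)"

definition admissible :: "real \<Rightarrow> real \<Rightarrow> bool" where
  "admissible t z \<longleftrightarrow> \<bar>z - a b w\<bar> \<le> t \<and> (\<forall>i\<in>D. lower i t \<le> z \<and> z \<le> upper i t)"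

definition errors :: "real set" where
  "errors = {eps_single a b w i |i. i \<in> D} \<union> {eps_pair a b w i j |i j. i \<in> D \<and> j \<in> D}"

lemma finite_errors: "finite errors"
proof -
  have "errors = eps_single a b w ` D \<union> (\<lambda>(i, j). eps_pair a b w i j) ` (D \<times> D)"
    by (auto simp: errors_def)
  then show ?thesis using finite_D by simp
qed

lemma errors_nonempty: "errors \<noteq> {}"
  using D_nonempty by (auto simp: errors_def)

lemma eps_single_le_iff_upper:
  assumes "i \<in> D" "a b i * a i w \<le> a b w" "0 \<le> t"
  shows "eps_single a b w i \<le> t \<longleftrightarrow> a b w - t \<le> upper i t"
  by (rule crossing_le_iff[where l = "\<lambda>t. a b w - t"])
    (use assms bi_pos iw_pos in \<open>auto intro: upper_barrier_strict_mono
        simp: eps_single_crossing_upper eps_single_nonneg\<close>)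

lemma eps_single_le_iff_lower:
  assumes "i \<in> D" "a b w \<le> a b i * a i w" "0 \<le> t"
  shows "eps_single a b w i \<le> t \<longleftrightarrow> lower i t \<le> a b w + t"
  by (rule crossing_le_iff[where h = "\<lambda>t. a b w + t"])
    (use assms bi_pos iw_pos bw_pos in \<open>auto intro: lower_barrier_antimono
        simp: eps_single_crossing_lower eps_single_nonneg\<close>)

lemma eps_pair_le_iff:
  assumes "i \<in> D" "j \<in> D" "a b i * a i w \<le> a b j * a j w" "0 \<le> t"
  shows "eps_pair a b w i j \<le> t \<longleftrightarrow> lower j t \<le> upper i t"
  by (rule crossing_le_iff)
    (use assms bi_pos iw_pos in \<open>auto intro: upper_barrier_strict_mono lower_barrier_antimono
        simp: eps_pair_crossing eps_pair_nonneg\<close>)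

lemma errors_le_if_admissible:
  assumes "admissible t z" "e \<in> errors"
  shows "e \<le> t"
proof -
  have t: "0 \<le> t" and z: "a b w - t \<le> z" "z \<le> a b w + t"
    and bar: "\<And>i. i \<in> D \<Longrightarrow> lower i t \<le> z \<and> z \<le> upper i t"
    using assms(1) by (auto simp: admissible_def)
  have pair: "eps_pair a b w i j \<le> t"
    if "i \<in> D" "j \<in> D" "a b i * a i w \<le> a b j * a j w" for i j
    using eps_pair_le_iff[OF that t] bar[OF that(1)] bar[OF that(2)] by linarith
  from assms(2) consider i where "i \<in> D" "e = eps_single a b w i"
    | i j where "i \<in> D" "j \<in> D" "e = eps_pair a b w i j"
    by (auto simp: errors_def)
  then show ?thesis
  proof cases
    case 1
    show ?thesis
    proof (cases "a b i * a i w \<le> a b w")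
      case True
      then show ?thesis using eps_single_le_iff_upper[of i t] 1 t z bar[of i] by linarith
    next
      case False
      then show ?thesis using eps_single_le_iff_lower[of i t] 1 t z bar[of i] by linarith
    qed
  next
    case 2
    then show ?thesis using pair[of i j] pair[of j i] eps_pair_commute[of a b w i j]
      by (cases "a b i * a i w \<le> a b j * a j w") auto
  qed
qed

text \<open>Barriers that start in the right order stay in it, so only the others need a radius.\<close>

lemma barriers_ordered:
  assumes "\<And>e. e \<in> errors \<Longrightarrow> e \<le> t" "0 \<le> t"
  shows "i \<in> D \<Longrightarrow> a b w - t \<le> upper i t"
    and "j \<in> D \<Longrightarrow> lower j t \<le> a b w + t"
    and "i \<in> D \<Longrightarrow> j \<in> D \<Longrightarrow> lower j t \<le> upper i t"
proof -
  have up: "a b i * a i w \<le> upper i t" and low: "lower i t \<le> a b i * a i w" if "i \<in> D" for i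
    using that bi_pos iw_pos assms(2)
    by (auto intro: product_le_upper_barrier lower_barrier_le_product)
  have single: "eps_single a b w i \<le> t" if "i \<in> D" for i
    using that by (intro assms(1)) (auto simp: errors_def)
  have pair: "eps_pair a b w i j \<le> t" if "i \<in> D" "j \<in> D" for i j
    using that by (intro assms(1)) (auto simp: errors_def)
  show "a b w - t \<le> upper i t" if "i \<in> D"
    using eps_single_le_iff_upper[OF that _ assms(2)] single[OF that] up[OF that] assms(2)
    by linarith
  show "lower j t \<le> a b w + t" if "j \<in> D"
    using eps_single_le_iff_lower[OF that _ assms(2)] single[OF that] low[OF that] assms(2)
    by linarith
  show "lower j t \<le> upper i t" if "i \<in> D" "j \<in> D"
    using eps_pair_le_iff[OF that _ assms(2)] pair[OF that] up[OF that(1)] low[OF that(2)]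
    by linarith
qed

abbreviation radius :: real where
  "radius \<equiv> Max errors"

lemma errors_le_radius: "e \<in> errors \<Longrightarrow> e \<le> radius"
  using finite_errors by simp

lemma radius_nonneg: "0 \<le> radius"
proof -
  obtain i where "i \<in> D" using D_nonempty by auto
  then have "eps_single a b w i \<in> errors" by (auto simp: errors_def)
  then show ?thesis using errors_le_radius eps_single_nonneg order_trans by blast
qed

text \<open>
  If the maximum is the \<open>eps_single\<close> of a criterion whose product equals \<open>a b w\<close>, it is \<open>0\<close>, and it
  is also the error of that criterion paired with itself.
\<close>

lemma ex_modified_abw: "\<exists>z. modified_abw D a b w radius z"
proof -
  have "radius \<in> errors" using finite_errors errors_nonempty by simp
  then consider i where "i \<in> D" "radius = eps_single a b w i"
    | i j where "i \<in> D" "j \<in> D" "radius = eps_pair a b w i j"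
    by (auto simp: errors_def)
  then show ?thesis
  proof cases
    case 1
    consider "a b i * a i w < a b w" | "a b i * a i w > a b w" | "a b i * a i w = a b w"
      by linarith
    then show ?thesis
    proof cases
      case 3
      have "upper i 0 = a b w" using 3 by (simp add: upper_barrier_def)
      then have "radius \<le> 0" using eps_single_le_iff_upper[of i 0] 1 3 by simp
      then have "radius = eps_pair a b w i i" using radius_nonneg by (simp add: eps_pair_def)
      then show ?thesis using 1 unfolding modified_abw_def by blast
    qed (use 1 in \<open>auto simp: modified_abw_def D_less_def D_greater_def\<close>)
  next
    case 2
    then show ?thesis
      using eps_pair_commute[of a b w i j] linear[of "a b i * a i w" "a b j * a j w"]
      unfolding modified_abw_def by metis
  qed
qed

text \<open>
  In each of the three cases \<open>z\<close> is the common value of a lower and an upper barrier. At the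
  radius every lower barrier is at most every upper one, so \<open>z\<close> respects all barriers, and
  any other admissible value would have to lie between \<open>z\<close> and \<open>z\<close>.
\<close>

lemma modified_abw_admissible:
  assumes "modified_abw D a b w radius z"
  shows "admissible radius z \<and> (\<forall>z'. admissible radius z' \<longrightarrow> z' = z) \<and> 0 < z"
proof -
  note ordered = barriers_ordered[OF errors_le_radius radius_nonneg]
  from assms consider
      i where "i \<in> D" "z = a b w - radius" "z = upper i radius"
    | j where "j \<in> D" "z = lower j radius" "z = a b w + radius"
    | i j where "i \<in> D" "j \<in> D" "z = lower j radius" "z = upper i radius"
    unfolding modified_abw_def
  proof (elim disjE bexE conjE)
    fix i assume i: "i \<in> D_less D a b w" "radius = eps_single a b w i"
      "z = a b w - eps_single a b w i"
    then have "i \<in> D" "a b i * a i w \<le> a b w" by (auto simp: D_less_def)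
    then show thesis
      using that(1)[of i] i eps_single_crossing_upper[of a b i w] bi_pos iw_pos by simp
  next
    fix j assume j: "j \<in> D_greater D a b w" "radius = eps_single a b w j"
      "z = a b w + eps_single a b w j"
    then have "j \<in> D" "a b w \<le> a b j * a j w" by (auto simp: D_greater_def)
    then show thesis
      using that(2)[of j] j eps_single_crossing_lower[of a b j w] bi_pos iw_pos bw_pos by simp
  next
    fix i j assume ij: "i \<in> D" "j \<in> D" "a b i * a i w \<le> a b j * a j w"
      "radius = eps_pair a b w i j"
      "z = (a b i + eps_pair a b w i j) * (a i w + eps_pair a b w i j)"
    then have "z = upper i radius" by (simp add: upper_barrier_def)
    then show thesis
      using that(3)[of i j] ij eps_pair_crossing[of a b i w j] bi_pos iw_pos by simp
  qed
  then show ?thesis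
  proof cases
    case 1
    have "0 < z"
      unfolding 1(3) using 1(1) upper_barrier_pos bi_pos iw_pos radius_nonneg by simp
    moreover have "z' = z" if "admissible radius z'" for z'
      using that 1 unfolding admissible_def by force
    moreover have "lower k radius \<le> z \<and> z \<le> upper k radius" if "k \<in> D" for k
      using 1 that ordered(1)[of k] ordered(3)[of i k] by simp
    ultimately show ?thesis using 1 radius_nonneg by (simp add: admissible_def)
  next
    case 2
    have "0 < z" using 2 bw_pos radius_nonneg by simp
    moreover have "z' = z" if "admissible radius z'" for z'
      using that 2 unfolding admissible_def by force
    moreover have "lower k radius \<le> z \<and> z \<le> upper k radius" if "k \<in> D" for k
      using 2 that ordered(2)[of k] ordered(3)[of k j] by simp
    ultimately show ?thesis using 2 radius_nonneg by (simp add: admissible_def)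
  next
    case 3
    have "0 < z"
      unfolding 3(4) using 3(1) upper_barrier_pos bi_pos iw_pos radius_nonneg by simp
    moreover have "z' = z" if "admissible radius z'" for z'
      using that 3 unfolding admissible_def by (metis order_antisym)
    moreover have "lower k radius \<le> z \<and> z \<le> upper k radius" if "k \<in> D" for k
      using 3 that ordered(3)[of k j] ordered(3)[of i k] by simp
    moreover have "a b w - radius \<le> z" "z \<le> a b w + radius"
      using 3 ordered(1)[of i] ordered(2)[of j] by simp_all
    ultimately show ?thesis by (simp add: admissible_def abs_le_iff)
  qed
qed

lemma modified_abw_iff_admissible:
  obtains z where "0 < z" "\<And>z'. modified_abw D a b w radius z' \<longleftrightarrow> z' = z"
    "\<And>z'. admissible radius z' \<longleftrightarrow> z' = z"
proof -
  obtain z where z: "modified_abw D a b w radius z" using ex_modified_abw by blast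
  note * = modified_abw_admissible[OF z]
  show thesis
  proof (rule that)
    show "0 < z" using * by simp
    show "admissible radius z' \<longleftrightarrow> z' = z" for z' using * by blast
    show "modified_abw D a b w radius z' \<longleftrightarrow> z' = z" for z'
      using * modified_abw_admissible[of z'] z by blast
  qed
qed

end

section \<open>Modified systems and weights\<close>

text \<open>
  For \<open>z > 0\<close> both factors of \<open>z\<close> are positive, so the constraint on \<open>p = z / q\<close> can be solved for
  \<open>q\<close>. If \<open>x \<le> t\<close>, then \<open>x - t \<le> p\<close> holds by positivity of \<open>p\<close>, in accordance with the
  case distinction in \<open>upper_aiw\<close>.
\<close>

lemma factor_pair_iff:
  fixes x y z t p q :: real
  assumes "0 < x" "0 < y" "0 \<le> t" "0 < z"
  shows "\<bar>p - x\<bar> \<le> t \<and> \<bar>q - y\<bar> \<le> t \<and> p * q = z \<and> 0 \<le> p \<and> 0 \<le> q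
    \<longleftrightarrow> q \<in> {max (y - t) (z / (x + t)) .. upper_aiw x y t z} \<and> p = z / q"
    (is "?L \<longleftrightarrow> ?R")
proof (cases "0 < q")
  case False
  have "\<not> ?L" using False assms(4) by (cases "q = 0") auto
  moreover have "0 < z / (x + t)" using assms by simp
  then have "\<not> ?R" using False by auto
  ultimately show ?thesis by blast
next
  case True
  have up: "z / q \<le> x + t \<longleftrightarrow> z / (x + t) \<le> q"
    using True assms by (simp add: field_simps)
  have down: "x - t \<le> z / q \<longleftrightarrow> q \<le> z / (x - t)" if "t < x"
    using True that by (simp add: field_simps)
  have triv: "x - t \<le> z / q" if "\<not> t < x"
    using that True assms by (smt (verit) divide_pos_pos)
  have factor: "p * q = z \<longleftrightarrow> p = z / q" using True by (auto simp: field_simps)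
  have "0 \<le> z / q" using True assms by simp
  then show ?thesis
    using True up down triv unfolding factor upper_aiw_def by (auto simp: abs_le_iff)
qed

text \<open>
  Of the four comparisons between an end on the left and one on the right, two say that \<open>z\<close> respects
  the barriers and two hold trivially.
\<close>

lemma factor_range_nonempty:
  fixes x y z t :: real
  assumes "0 < x" "0 < y" "0 \<le> t" "0 < z"
    and "lower_barrier x y t \<le> z" "z \<le> upper_barrier x y t"
  shows "max (y - t) (z / (x + t)) \<le> upper_aiw x y t z"
proof -
  have "z / (x + t) \<le> y + t"
    using assms by (simp add: upper_barrier_def field_simps)
  moreover have "z / (x + t) \<le> z / (x - t)" if "t < x"
    using that assms by (intro divide_left_mono) auto
  moreover have "y - t \<le> z / (x - t)" if "t < x"
  proof (cases "t < y")
    case True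
    then show ?thesis using that assms(5) by (simp add: lower_barrier_def field_simps)
  next
    case False
    moreover have "0 < z / (x - t)" using that assms by simp
    ultimately show ?thesis by linarith
  qed
  ultimately show ?thesis using assms by (simp add: upper_aiw_def)
qed

lemma factor_within_barriers:
  fixes x y t p q :: real
  assumes "\<bar>p - x\<bar> \<le> t" "\<bar>q - y\<bar> \<le> t" "0 \<le> p" "0 \<le> q"
  shows "lower_barrier x y t \<le> p * q \<and> p * q \<le> upper_barrier x y t"
  unfolding lower_barrier_def upper_barrier_def using assms
  by (auto intro!: mult_mono)

text \<open>
  A criterion that ties with the best or the worst one has preferences \<open>1\<close> and \<open>A = a b w\<close> in some
  order. Its upper barrier is at least \<open>1 * (A + t)\<close> and its lower one at most
  \<open>1 * max 0 (A - t)\<close>, so it constrains a nonnegative \<open>z\<close> no further than \<open>A\<close> itself does.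
\<close>

lemma lower_barrier_one_le:
  assumes "0 \<le> t" "A - t \<le> z" "0 \<le> z"
  shows "lower_barrier 1 A t \<le> z"
proof -
  have "lower_barrier 1 A t \<le> 1 * max 0 (A - t)"
    unfolding lower_barrier_def using assms by (intro mult_right_mono) auto
  then show ?thesis using assms by simp
qed

lemma le_upper_barrier_one:
  assumes "0 \<le> t" "z \<le> A + t" "0 \<le> A"
  shows "z \<le> upper_barrier 1 A t"
proof -
  have "1 * (A + t) \<le> upper_barrier 1 A t"
    unfolding upper_barrier_def using assms by (intro mult_right_mono) auto
  then show ?thesis using assms by simp
qed

text \<open>Ratios of weights multiply: \<open>(v b / v i) * (v i / v w) = v b / v w\<close>.\<close>

lemma modified_feasible_of_weights:
  assumes "weight_feasible n n1 n2 D' a b w v \<epsilon>"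
    and "D' \<subseteq> {1..n}" "b \<in> {1..n}" "w \<in> {1..n}"
  shows "modified_feasible D' a b w (\<lambda>i. v b / v i) (\<lambda>i. v i / v w) (v b / v w) \<epsilon>"
  using assms unfolding weight_feasible_def modified_feasible_def by auto

text \<open>
  The weights \<open>z\<close>, \<open>q i\<close>, \<open>1\<close> of \<open>b\<close>, \<open>i\<close>, \<open>w\<close> have the required ratios, and these survive
  normalisation. The condition \<open>z > 0\<close> keeps the denominators \<open>q i\<close> away from \<open>0\<close>. The total
  weight \<open>1\<close> counts \<open>b\<close> and \<open>w\<close> with multiplicities \<open>n1\<close> and \<open>n2\<close>, so every index outside
  \<open>D'\<close>, \<open>b\<close>, \<open>w\<close> gets the value \<open>0\<close>.
\<close>

lemma weights_of_modified_feasible: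
  assumes feas: "modified_feasible D' a b w p q z \<epsilon>" and "0 < z"
    and "finite D'" "b \<noteq> w" "b \<notin> D'" "w \<notin> D'" "1 \<le> n2"
  shows "\<exists>v. weight_feasible n n1 n2 D' a b w v \<epsilon>"
proof -
  have q: "0 < q i" "p i = z / q i" if "i \<in> D'" for i
  proof -
    have *: "p i * q i = z" "0 \<le> q i" using feas that by (auto simp: modified_feasible_def)
    then show "0 < q i" using \<open>0 < z\<close> by (cases "q i = 0") auto
    then show "p i = z / q i" using * by (simp add: field_simps)
  qed
  define N where "N = real n1 * z + real n2 + (\<Sum>k\<in>D'. q k)"
  have "0 \<le> (\<Sum>k\<in>D'. q k)" using q by (intro sum_nonneg) (simp add: less_imp_le)
  then have N: "0 < N" using \<open>0 < z\<close> \<open>1 \<le> n2\<close> by (simp add: N_def add_nonneg_pos add_pos_nonneg)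
  define v where "v j = (if j = b then z else if j = w then 1 else if j \<in> D' then q j else 0) / N"
    for j
  have vb: "v b = z / N" and vw: "v w = 1 / N" using assms by (auto simp: v_def)
  have vi: "v i = q i / N" if "i \<in> D'" for i using that assms by (auto simp: v_def)
  have "(\<Sum>k\<in>D'. v k) = (\<Sum>k\<in>D'. q k) / N"
    by (simp add: vi sum_divide_distrib)
  then have "real n1 * v b + real n2 * v w + (\<Sum>k\<in>D'. v k)
      = (real n1 * z + real n2 + (\<Sum>k\<in>D'. q k)) / N"
    unfolding vb vw by (simp add: add_divide_distrib)
  then have "real n1 * v b + real n2 * v w + (\<Sum>k\<in>D'. v k) = 1"
    using N by (simp add: N_def)
  moreover have "0 \<le> v j" for j using N q \<open>0 < z\<close> by (auto simp: v_def less_imp_le)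
  moreover have "v i \<noteq> 0 \<and> \<bar>v b / v i - a b i\<bar> \<le> \<epsilon> \<and> \<bar>v i / v w - a i w\<bar> \<le> \<epsilon>"
    if "i \<in> D'" for i
    using that q[OF that] N feas by (auto simp: vb vw vi modified_feasible_def)
  ultimately have "weight_feasible n n1 n2 D' a b w v \<epsilon>"
    using N feas by (simp add: weight_feasible_def vb vw modified_feasible_def)
  then show ?thesis by blast
qed

section \<open>The optimal values and all optimal modifications\<close>

theorem theorem4:
  fixes n n1 n2 :: nat and bs ws :: "nat \<Rightarrow> nat" and a :: "nat \<Rightarrow> nat \<Rightarrow> real"
    and b w :: nat and D D' :: "nat set" and \<epsilon>s \<eta>s :: real
  assumes pcs: "multi_pcs n n1 n2 bs ws a"
    and b: "b = bs 1" and w: "w = ws 1"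
    and D: "D = {1..n} - {b, w}"
    and D': "D' = crit_rest n n1 n2 bs ws"
    and eps: "\<epsilon>s = eps_star n n1 n2 D' a b w"
    and eta: "\<eta>s = eta_star D' a b w"
  shows "(\<exists>v. weight_feasible n n1 n2 D' a b w v \<epsilon>s) \<and>
    (\<exists>p q z. modified_feasible D' a b w p q z \<eta>s) \<and>
    \<epsilon>s = \<eta>s \<and>
    \<eta>s = Max ({eps_single a b w i |i. i \<in> D} \<union> {eps_pair a b w i j |i j. i \<in> D \<and> j \<in> D}) \<and>
    (\<exists>z. (\<forall>z'. modified_abw D a b w \<eta>s z' \<longleftrightarrow> z' = z) \<and>
         optimally_modified_pcs D' a b w =
           {(p, q). (p, q) \<in> completed_pcs D' b w z \<and>
              (\<forall>i\<in>D'. q i \<in> {max (a i w - \<epsilon>s) (z / (a b i + \<epsilon>s)) .. upper_aiw (a b i) (a i w) \<epsilon>s z} \<and>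
                      p i = z / q i)})"
proof -
  have n12: "1 \<le> n1" "1 \<le> n2" using pcs by (auto simp: multi_pcs_def)
  have bw_in: "b \<in> bs ` {1..n1}" "w \<in> ws ` {1..n2}" using n12 b w by auto
  have bw: "b \<in> {1..n}" "w \<in> {1..n}" "b \<noteq> w"
    using pcs bw_in unfolding multi_pcs_def by blast+
  have D'_sub: "D' \<subseteq> {1..n}" "D' \<subseteq> D" "b \<notin> D'" "w \<notin> D'"
    using bw_in by (auto simp: D' D crit_rest_def)
  have ge1: "1 \<le> a b i" "1 \<le> a i w" "a b i \<le> a b w" if "i \<in> D" for i
  proof -
    have "\<forall>i\<in>{1..n} - {b, w}. 1 \<le> a b i \<and> a b i \<le> a b w \<and> 1 \<le> a i w \<and> a i w \<le> a b w"
      using pcs unfolding multi_pcs_def b w by blast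
    then show "1 \<le> a b i" "1 \<le> a i w" "a b i \<le> a b w" using that by (simp_all add: D)
  qed
  have extra: "a b i = 1 \<and> a i w = a b w \<or> a b i = a b w \<and> a i w = 1" if "i \<in> D - D'" for i
  proof -
    have one: "1 \<in> {1..n1}" "1 \<in> {1..n2}" using n12 by auto
    have "i \<in> bs ` {1..n1} \<or> i \<in> ws ` {1..n2}"
      using that by (auto simp: D D' crit_rest_def)
    moreover have eq: "\<forall>k\<in>{1..n1}. \<forall>l\<in>{1..n2}. a (bs k) (ws l) = a b w"
      "\<forall>k\<in>{1..n1}. a b (bs k) = 1" "\<forall>l\<in>{1..n2}. a (ws l) w = 1"
      using pcs unfolding multi_pcs_def b w by blast+
    moreover have "a (bs k) w = a b w" if "k \<in> {1..n1}" for k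
      using eq(1) that one w by simp
    moreover have "a b (ws l) = a b w" if "l \<in> {1..n2}" for l
      using eq(1) that one b by simp
    ultimately show ?thesis by auto
  qed
  have "D \<noteq> {}"
  proof -
    have dis: "inj_on bs {1..n1}" "inj_on ws {1..n2}" "bs ` {1..n1} \<inter> ws ` {1..n2} = {}"
      "bs ` {1..n1} \<subseteq> {1..n}" "ws ` {1..n2} \<subseteq> {1..n}" "2 \<le> n1 \<or> 2 \<le> n2"
      using pcs unfolding multi_pcs_def by blast+
    have cross: "b \<notin> ws ` {1..n2}" "w \<notin> bs ` {1..n1}"
      using dis(3) bw_in by blast+
    \<comment> \<open>A second best or a second worst criterion lies in \<open>D\<close>.\<close>
    from dis(6) have "bs 2 \<in> D \<or> ws 2 \<in> D"
    proof
      assume "2 \<le> n1"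
      then have "bs 2 \<in> bs ` {1..n1}" "bs 2 \<noteq> b"
        using inj_onD[OF dis(1), of 2 1] by (auto simp: b)
      then have "bs 2 \<in> {1..n}" "bs 2 \<noteq> b" "bs 2 \<noteq> w"
        using dis(4) cross(2) by (blast, blast, metis)
      then show ?thesis by (simp add: D)
    next
      assume "2 \<le> n2"
      then have "ws 2 \<in> ws ` {1..n2}" "ws 2 \<noteq> w"
        using inj_onD[OF dis(2), of 2 1] by (auto simp: w)
      then have "ws 2 \<in> {1..n}" "ws 2 \<noteq> w" "ws 2 \<noteq> b"
        using dis(5) cross(1) by (blast, blast, metis)
      then show ?thesis by (simp add: D)
    qed
    then show ?thesis by blast
  qed
  then obtain i0 where "i0 \<in> D" by blast
  then have bw_pos: "0 < a b w" using ge1[of i0] by linarith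
  interpret best_worst_preferences D a b w
    using \<open>D \<noteq> {}\<close> bw_pos ge1 by unfold_locales (auto simp: D intro: less_le_trans[OF zero_less_one])
  have pos: "0 < a b i" "0 < a i w" if "i \<in> D'" for i
    using that D'_sub(2) bi_pos iw_pos by auto

  obtain z where z: "0 < z" and z_abw: "\<And>z'. modified_abw D a b w radius z' \<longleftrightarrow> z' = z"
    and z_adm: "\<And>z'. admissible radius z' \<longleftrightarrow> z' = z"
    using modified_abw_iff_admissible by blast

  \<comment> \<open>Constraints over \<open>D'\<close> already imply the barriers over all of \<open>D\<close>.\<close>
  have admissible_of_feasible: "admissible t z'" if "modified_feasible D' a b w p q z' t"
    for p q t z'
    unfolding admissible_def
  proof (intro conjI ballI)
    have t: "0 \<le> t" "a b w - t \<le> z'" "z' \<le> a b w + t" "0 \<le> z'"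
      using that by (auto simp: modified_feasible_def)
    show "\<bar>z' - a b w\<bar> \<le> t" using that by (simp add: modified_feasible_def)
    fix i assume i: "i \<in> D"
    have "lower i t \<le> z' \<and> z' \<le> upper i t"
    proof (cases "i \<in> D'")
      case True
      then show ?thesis
        using factor_within_barriers[of "p i" "a b i" t "q i" "a i w"] that
        by (auto simp: modified_feasible_def)
    next
      case False
      have "lower_barrier 1 (a b w) t \<le> z'" "z' \<le> upper_barrier 1 (a b w) t"
        using t bw_pos by (auto intro: lower_barrier_one_le le_upper_barrier_one)
      then show ?thesis
        using extra[of i] i False
        by (auto simp: lower_barrier_commute[of "a b w" 1] upper_barrier_commute[of "a b w" 1])
    qed
    then show "lower i t \<le> z'" "z' \<le> upper i t" by simp_all
  qed

  have feasible_iff: "modified_feasible D' a b w p q z' radius \<longleftrightarrow> z' = z \<and>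
      (\<forall>i\<in>D'. q i \<in> {max (a i w - radius) (z / (a b i + radius)) ..
          upper_aiw (a b i) (a i w) radius z}
        \<and> p i = z / q i)" (is "_ \<longleftrightarrow> _ \<and> (\<forall>i\<in>D'. ?Q q p i)") for p q z'
  proof -
    have "\<bar>z - a b w\<bar> \<le> radius" using z_adm[of z] by (simp add: admissible_def)
    then have "modified_feasible D' a b w p q z radius \<longleftrightarrow> (\<forall>i\<in>D'. ?Q q p i)"
      using z factor_pair_iff[OF pos radius_nonneg z]
      by (simp add: modified_feasible_def)
    then show ?thesis using admissible_of_feasible[of p q z' radius] z_adm[of z'] by metis
  qed

  have ex_feasible: "\<exists>p q. modified_feasible D' a b w p q z radius"
  proof -
    \<comment> \<open>Any point of the intervals would do; this is the left end.\<close>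
    define q where "q i = max (a i w - radius) (z / (a b i + radius))" for i
    have "q i \<le> upper_aiw (a b i) (a i w) radius z" if "i \<in> D'" for i
    proof -
      have "i \<in> D" using that D'_sub(2) by blast
      then have "lower i radius \<le> z" "z \<le> upper i radius"
        using z_adm[of z] unfolding admissible_def by simp_all
      then show ?thesis
        unfolding q_def using factor_range_nonempty[OF pos[OF that] radius_nonneg z] by blast
    qed
    then have "modified_feasible D' a b w (\<lambda>i. z / q i) q z radius"
      unfolding feasible_iff by (simp add: q_def)
    then show ?thesis by blast
  qed
  then obtain p q where pq: "modified_feasible D' a b w p q z radius" by blast

  have radius_le: "radius \<le> t" if "modified_feasible D' a b w p q z' t" for p q z' t
    using errors_le_if_admissible[OF admissible_of_feasible[OF that]]
      finite_errors errors_nonempty by simp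

  have eta_val: "\<eta>s = radius"
    unfolding eta eta_star_def using pq radius_le by (intro cInf_eq_minimum) auto

  have "finite D'" using D'_sub(1) finite_subset by blast
  then obtain v where v: "weight_feasible n n1 n2 D' a b w v radius"
    using weights_of_modified_feasible[OF pq z _ bw(3) D'_sub(3,4) n12(2)] by blast
  have eps_val: "\<epsilon>s = radius"
    unfolding eps eps_star_def
    using v radius_le[OF modified_feasible_of_weights[OF _ D'_sub(1) bw(1,2)]]
    by (intro cInf_eq_minimum) auto

  have "optimally_modified_pcs D' a b w =
      {(p, q). (p, q) \<in> completed_pcs D' b w z \<and>
        (\<forall>i\<in>D'. q i \<in> {max (a i w - radius) (z / (a b i + radius)) ..
            upper_aiw (a b i) (a i w) radius z} \<and> p i = z / q i)}"
    unfolding optimally_modified_pcs_def eta[symmetric] eta_val feasible_iff by blast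
  then show ?thesis
    using v pq z_abw unfolding eps_val eta_val errors_def[symmetric] by blast
qed

end
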